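(* Let $n \ge 2$ be an integer and let $S = \{ b_{j_1\ldots j_{n-1}} : j_1, \ldots, j_{n-1} \in \mathbb{Z}_{+} \}$ be a multidimensional sequence of real numbers. Suppose that $S$ is a Hankel multidimensional sequence, i.e., for all $j_1,\ldots,j_{n-1}, l_1,\ldots,l_{n-1} \in \mathbb{Z}_{+}$, $$ j_1 + 2j_2 + \cdots + (n-1)j_{n-1} = l_1 + 2l_2 + \cdots + (n-1)l_{n-1} \quad\Longrightarrow\quad b_{j_1\ldots j_{n-1}} = b_{l_1\ldots l_{n-1}}. $$ Let $V = \{ v_k : k \in \mathbb{Z}_{+}\}$ be the (well-defined) infinite sequence determined by $$ v_{j_1+2j_2+\cdots+(n-1)j_{n-1}} = b_{j_1\ldots j_{n-1}} \quad \text{for all } j_1,\ldots,j_{n-1} \in \mathbb{Z}_{+}. $$ If for every positive integer $p$ the $p \times p$ Hankel matrix $H_p = (v_{i+j})_{i,j=0}^{p-1}$ is positive semi-definite, then $S$ is a multidimensional moment sequence.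
   Context: $\mathbb{Z}_{+}$ denotes the set of all nonnegative integers. A multidimensional sequence $S = \{ b_{j_1\ldots j_{n-1}} : j_1, \ldots, j_{n-1} \in \mathbb{Z}_{+} \}$ of real numbers is called a multidimensional moment sequence if there is a nonnegative (Borel) measure $\mu$ on $\mathbb{R}^{n-1}$ such that, for all $j_1,\ldots,j_{n-1} \in \mathbb{Z}_{+}$, $$ b_{j_1\ldots j_{n-1}} = \int_{\mathbb{R}^{n-1}} t_1^{j_1}\cdots t_{n-1}^{j_{n-1}} \, d\mu(t), $$ with all these integrals finite. A real symmetric matrix $H$ is positive semi-definite if $x^\top H x \ge 0$ for all real vectors $x$. *)

theory Defs
  imports "HOL-Analysis.Analysis" "Jordan_Normal_Form.Matrix"
begin

no_notation vec_index (infixl \<open>$\<close> 100)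
no_notation scalar_prod (infix \<open>\<bullet>\<close> 70)

(* A multi-index over the finite coordinate type 'm is a function 'm => nat, and a
   multidimensional sequence is a real function of multi-indices.  The constraint on
   "sets \<mu>" makes \<mu> a Borel measure; Isabelle measures are nonnegative by type. *)
definition multidim_moment_sequence :: "(('m::finite \<Rightarrow> nat) \<Rightarrow> real) \<Rightarrow> bool" where
  "multidim_moment_sequence b \<longleftrightarrow>
     (\<exists>\<mu> :: (real ^ 'm) measure. sets \<mu> = sets borel \<and>
        (\<forall>j. integrable \<mu> (\<lambda>t. \<Prod>i\<in>UNIV. (t $ i) ^ j i) \<and>
             b j = (\<integral>t. (\<Prod>i\<in>UNIV. (t $ i) ^ j i) \<partial>\<mu>)))"

(* e k is the k-th coordinate, k = 1, ..., n - 1, so that j (e k) is the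
   component j_k and the value is j_1 + 2 j_2 + ... + (n - 1) j_(n-1). *)
definition multi_index_weight :: "nat \<Rightarrow> (nat \<Rightarrow> 'm) \<Rightarrow> ('m \<Rightarrow> nat) \<Rightarrow> nat" where
  "multi_index_weight n e j = (\<Sum>k = 1..n - 1. k * j (e k))"

definition hankel_multidim_sequence ::
    "nat \<Rightarrow> (nat \<Rightarrow> 'm) \<Rightarrow> (('m \<Rightarrow> nat) \<Rightarrow> real) \<Rightarrow> bool" where
  "hankel_multidim_sequence n e b \<longleftrightarrow>
     (\<forall>j l. multi_index_weight n e j = multi_index_weight n e l \<longrightarrow> b j = b l)"

definition hankel_mat :: "(nat \<Rightarrow> real) \<Rightarrow> nat \<Rightarrow> real mat" where
  "hankel_mat v p = mat p p (\<lambda>(i, j). v (i + j))"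

definition positive_semidefinite_mat :: "real mat \<Rightarrow> bool" where
  "positive_semidefinite_mat H \<longleftrightarrow>
     transpose_mat H = H \<and>
     (\<forall>x \<in> carrier_vec (dim_row H). scalar_prod x (H *\<^sub>v x) \<ge> 0)"

end

theory Submission
  imports Defs "HOL-Probability.Probability"
begin

text \<open>
  Since \<open>b\<close> depends on a multi-index only through its weight, it suffices to represent \<open>v\<close> by a
  measure \<open>M\<close> on the line, \<open>v k = \<integral>x. x ^ k \<partial>M\<close>. The image of \<open>M\<close> under the moment curve
  \<open>x \<mapsto> (x, x\<^sup>2, \<dots>, x ^ (n - 1))\<close> then represents \<open>b\<close>: a monomial with exponents \<open>j\<close> pulls back along
  the curve to \<open>x\<close> raised to the weight of \<open>j\<close>
  (\<open>integrable_and_integral_monomial_power_curve\<close>). The measure \<open>M\<close> is supplied by Hamburger's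
  theorem (\<open>hamburger\<close>), and the bulk of the development proves that theorem from three facts.

  The functional \<open>x ^ k \<mapsto> v k\<close> on polynomials is nonnegative on squares, which is what positive
  semidefiniteness of the Hankel matrices says. A nonnegative real polynomial is its minimum plus
  \<open>(x - a)\<^sup>2\<close> times a nonnegative polynomial of smaller degree; so, by induction on the degree, the
  functional is nonnegative on all nonnegative polynomials
  (\<open>nonneg_on_squares_imp_nonneg_on_nonneg_polys\<close>).

  By a separation argument, any finite number of the values \<open>v 0, v 1, \<dots>\<close>, normalised to
  \<open>v 0 = 1\<close>, can be approximated by the moments of a finitely supported probability measure
  (\<open>convex_set_approximates_nonneg_functional\<close>): a hyperplane that separates \<open>v\<close> from all such
  moment vectors would yield a nonnegative polynomial on which the functional is negative.

  The resulting sequence of probability measures has bounded moments. It is therefore tight, and by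
  Helly's selection theorem it has a weakly convergent subsequence. Bounded moments of order \<open>2 k\<close>
  make the powers \<open>x ^ k\<close> uniformly integrable, so the moments of order \<open>k\<close> pass to the weak limit
  (\<open>moment_limit\<close>).
\<close>

section \<open>Functionals that are nonnegative on squares\<close>

text \<open>The absolute value of a nonconstant polynomial tends to infinity, so outside a large interval
  \<open>q\<close> is at least its value at \<open>0\<close>, and compactness of the interval does the rest.\<close>
lemma nonneg_poly_attains_min:
  fixes q :: "real poly"
  assumes nonneg: "\<And>x. 0 \<le> poly q x"
  obtains a where "\<And>x. poly q a \<le> poly q x"
proof (cases "degree q = 0")
  case True
  then obtain c where "q = [:c:]" by (rule degree_eq_zeroE)
  then show ?thesis using that by simp
next
  case False
  then have "filterlim (poly q) at_infinity at_infinity"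
    by (intro filterlim_poly_at_infinity) auto
  then have "eventually (\<lambda>x. poly q 0 \<le> norm (poly q x)) at_infinity"
    unfolding filterlim_at_infinity[OF order_refl]
    by (cases "poly q 0 = 0") (use nonneg[of 0] in auto)
  then obtain R where R: "\<And>x. R \<le> norm x \<Longrightarrow> poly q 0 \<le> norm (poly q x)"
    unfolding eventually_at_infinity by blast
  define I where "I = {- \<bar>R\<bar>..\<bar>R\<bar>}"
  have "compact I" "I \<noteq> {}" "0 \<in> I" by (auto simp: I_def)
  moreover have "continuous_on I (poly q)" by (intro continuous_intros)
  ultimately obtain a where a: "a \<in> I" "\<And>x. x \<in> I \<Longrightarrow> poly q a \<le> poly q x"
    using continuous_attains_inf[of I "poly q"] by blast
  have "poly q a \<le> poly q x" for x
  proof (cases "x \<in> I")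
    case False
    then have "R \<le> norm x" by (auto simp: I_def)
    with R[of x] nonneg[of x] a(2)[OF \<open>0 \<in> I\<close>] show ?thesis by simp
  qed (use a in simp)
  then show ?thesis by (rule that)
qed

text \<open>Subtracting the minimum creates a real root \<open>a\<close> that is also a critical point, hence a double
  root. Dividing it out leaves a nonnegative polynomial; no complex roots are involved.\<close>
lemma nonneg_poly_decomposition:
  fixes q :: "real poly"
  assumes nonneg: "\<And>x. 0 \<le> poly q x"
  obtains a m s where "q = [:m:] + [:-a, 1:] * [:-a, 1:] * s" "0 \<le> m" "\<And>x. 0 \<le> poly s x"
proof -
  obtain a where a: "\<And>x. poly q a \<le> poly q x"
    using nonneg_poly_attains_min[OF nonneg] by blast
  have "poly (q - [:poly q a:]) a = 0" by simp
  then obtain r where r: "q - [:poly q a:] = [:-a, 1:] * r"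
    unfolding poly_eq_0_iff_dvd by (rule dvdE)
  have "poly (pderiv q) a = 0"
    using DERIV_local_min[of "poly q" "poly (pderiv q) a" a 1] poly_DERIV[of q a] a by simp
  moreover have "pderiv q = pderiv (q - [:poly q a:])"
    by (simp add: pderiv_diff)
  ultimately have "poly r a = 0"
    by (simp add: r pderiv_mult pderiv_pCons del: mult_pCons_left)
  then obtain s where s: "r = [:-a, 1:] * s"
    unfolding poly_eq_0_iff_dvd by (rule dvdE)
  have eq: "q = [:poly q a:] + [:-a, 1:] * [:-a, 1:] * s"
    using r unfolding s by (simp only: algebra_simps)
  have off: "0 \<le> poly s x" if "x \<noteq> a" for x
  proof -
    have "poly q x = poly q a + (x - a) * (x - a) * poly s x"
      by (subst eq) (simp add: algebra_simps)
    with a[of x] have "0 \<le> (x - a) * (x - a) * poly s x" by simp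
    moreover have "0 < (x - a) * (x - a)" using that by (cases "x < a") (auto intro: mult_pos_pos mult_neg_neg)
    ultimately show ?thesis by (simp add: zero_le_mult_iff)
  qed
  \<comment> \<open>At \<open>a\<close> itself the division carries no information, and continuity of \<open>s\<close> decides the sign.\<close>
  have "(poly s \<longlongrightarrow> poly s a) (at a)"
    by (rule isContD) simp
  then have "0 \<le> poly s a"
    by (rule tendsto_lowerbound) (auto simp: eventually_at_filter off)
  with off have "0 \<le> poly s x" for x by (cases "x = a") auto
  with eq nonneg[of a] show ?thesis by (intro that) auto
qed

text \<open>The induction needs the extra square factor \<open>r * r\<close>, which absorbs the factor
  \<open>(x - a)\<^sup>2\<close> that \<open>nonneg_poly_decomposition\<close> splits off. This avoids writing \<open>q\<close> itself as a sum
  of squares.\<close>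
lemma nonneg_on_squares_imp_nonneg_on_nonneg_polys:
  fixes L :: "real poly \<Rightarrow> real"
  assumes add: "\<And>p q. L (p + q) = L p + L q"
    and smult: "\<And>c p. L (Polynomial.smult c p) = c * L p"
    and square: "\<And>p. 0 \<le> L (p * p)"
    and nonneg: "\<And>x. 0 \<le> poly q x"
  shows "0 \<le> L q"
proof -
  have "0 \<le> L (r * r * q)" for r
    using nonneg
  proof (induction "degree q" arbitrary: q r rule: less_induct)
    case less
    obtain a m s where q: "q = [:m:] + [:-a, 1:] * [:-a, 1:] * s" and m: "0 \<le> m"
      and s: "\<And>x. 0 \<le> poly s x"
      using nonneg_poly_decomposition[OF less.prems] by blast
    have "r * r * q = Polynomial.smult m (r * r) + (r * [:-a, 1:]) * (r * [:-a, 1:]) * s"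
      unfolding q by (simp add: algebra_simps del: mult_pCons_left mult_pCons_right)
        (simp add: mult_pCons_left)
    then have split: "L (r * r * q) = m * L (r * r) + L ((r * [:-a, 1:]) * (r * [:-a, 1:]) * s)"
      by (simp only: add smult)
    have "0 \<le> L ((r * [:-a, 1:]) * (r * [:-a, 1:]) * s)"
    proof (cases "s = 0")
      case True
      then show ?thesis using smult[of 0 0] by simp
    next
      case False
      have deg: "degree ([:-a, 1:] * [:-a, 1:] * s) = 2 + degree s"
        using False by (simp add: degree_mult_eq del: mult_pCons_left)
      have "degree q = degree ([:-a, 1:] * [:-a, 1:] * s)"
        unfolding q by (rule degree_add_eq_right) (simp only: deg, simp)
      then show ?thesis by (intro less.hyps s) (simp only: deg)
    qed
    then show ?case using split m square[of r] by simp
  qed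
  from this[of 1] show ?thesis by simp
qed

section \<open>The functional of a Hankel matrix\<close>

text \<open>The linear functional with \<open>x ^ k \<mapsto> v k\<close>, the only candidate for integration of polynomials
  against a measure with moments \<open>v\<close>.\<close>
definition hankel_functional :: "(nat \<Rightarrow> real) \<Rightarrow> real poly \<Rightarrow> real" where
  "hankel_functional v p = (\<Sum>k\<le>degree p. coeff p k * v k)"

lemma hankel_functional_eq_sum:
  assumes "degree p \<le> N"
  shows "hankel_functional v p = (\<Sum>k\<le>N. coeff p k * v k)"
  unfolding hankel_functional_def
  by (rule sum.mono_neutral_left) (use assms in \<open>auto simp: coeff_eq_0\<close>)

lemma hankel_functional_add: "hankel_functional v (p + q) = hankel_functional v p + hankel_functional v q"
proof -
  define N where "N = max (degree p) (degree q)"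
  have "degree (p + q) \<le> N" "degree p \<le> N" "degree q \<le> N"
    by (auto simp: N_def degree_add_le_max)
  then show ?thesis
    by (simp add: hankel_functional_eq_sum[of _ N] algebra_simps sum.distrib)
qed

lemma hankel_functional_smult: "hankel_functional v (Polynomial.smult c p) = c * hankel_functional v p"
proof -
  have "degree (Polynomial.smult c p) \<le> degree p" by (rule degree_smult_le)
  then show ?thesis
    by (simp add: hankel_functional_eq_sum[of _ "degree p"] sum_distrib_left algebra_simps)
qed

lemma hankel_functional_sum: "hankel_functional v (sum f A) = (\<Sum>i\<in>A. hankel_functional v (f i))"
proof (induction A rule: infinite_finite_induct)
qed (simp_all add: hankel_functional_add, simp_all add: hankel_functional_def)

lemma hankel_functional_monom: "hankel_functional v (monom c k) = c * v k"
  by (simp add: hankel_functional_eq_sum[OF degree_monom_le] if_distrib[of "\<lambda>x. x * _"] cong: if_cong)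

text \<open>The value at a square is the quadratic form of the Hankel matrix at the coefficient vector.\<close>
lemma hankel_functional_square:
  "hankel_functional v (p * p) = (\<Sum>i\<le>degree p. \<Sum>j\<le>degree p. coeff p i * coeff p j * v (i + j))"
proof -
  have "p * p = (\<Sum>i\<le>degree p. monom (coeff p i) i) * (\<Sum>j\<le>degree p. monom (coeff p j) j)"
    by (simp add: poly_as_sum_of_monoms)
  also have "\<dots> = (\<Sum>i\<le>degree p. \<Sum>j\<le>degree p. monom (coeff p i * coeff p j) (i + j))"
    by (simp add: sum_product mult_monom)
  finally show ?thesis
    by (simp only: hankel_functional_sum hankel_functional_monom)
qed

lemma positive_semidefinite_hankel_mat_quadratic_form:
  assumes "positive_semidefinite_mat (hankel_mat v p)"
  shows "0 \<le> (\<Sum>i<p. \<Sum>j<p. x i * x j * v (i + j))"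
proof -
  have "scalar_prod (vec p x) (hankel_mat v p *\<^sub>v vec p x) = (\<Sum>i<p. \<Sum>j<p. x i * x j * v (i + j))"
    by (simp add: scalar_prod_def hankel_mat_def sum_distrib_left atLeast0LessThan algebra_simps)
  moreover have "vec p x \<in> carrier_vec (dim_row (hankel_mat v p))"
    by (simp add: hankel_mat_def)
  ultimately show ?thesis
    using assms unfolding positive_semidefinite_mat_def by metis
qed


section \<open>Approximation by finitely supported probability measures\<close>
lemma power_le_one_plus_even_power:
  fixes t :: real
  assumes "k \<le> N" "even N"
  shows "\<bar>t ^ k\<bar> \<le> 1 + t ^ N"
proof (cases "\<bar>t\<bar> \<le> 1")
  case True
  then have "\<bar>t\<bar> ^ k \<le> 1" by (simp add: power_le_one)
  moreover have "0 \<le> t ^ N" using assms by (simp add: zero_le_even_power)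
  ultimately show ?thesis by (simp add: power_abs)
next
  case False
  then have "\<bar>t\<bar> ^ k \<le> \<bar>t\<bar> ^ N" using assms by (intro power_increasing) auto
  also have "\<bar>t\<bar> ^ N = t ^ N" using assms by (simp add: power_even_abs)
  finally show ?thesis by (simp add: power_abs)
qed

text \<open>
  This is separation of \<open>v\<close> from a convex set containing the moment curve, restricted to the
  coordinates \<open>0, \<dots>, N\<close>. Let \<open>d\<close> be the infimum of the squared distance \<open>D\<close> from \<open>v\<close> to \<open>C\<close>,
  and suppose that \<open>d > 0\<close>. The infimum need not be attained, so take \<open>c\<close> with \<open>D c < d + \<epsilon>\<^sup>2\<close>.
  The distance cannot drop below \<open>d\<close> when \<open>c\<close> is moved a little towards a point of the curve; hence
  the polynomial \<open>x \<mapsto> (\<Sum>k\<le>N. (c k - v k) * (x ^ k - c k))\<close> becomes nonnegative after adding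
  \<open>\<epsilon> * K * (1 + x ^ N)\<close>. It is the restriction to the curve of an affine function that vanishes on the
  hyperplane through \<open>c\<close> orthogonal to \<open>c - v\<close>, and the value of that affine function at \<open>v\<close> is
  \<open>- D c\<close>. So the functional maps the nonnegative sum to \<open>- D c\<close> plus a term of order \<open>\<epsilon>\<close>, which
  bounds \<open>d\<close> by a multiple of every \<open>\<epsilon>\<close>.
\<close>
lemma convex_set_approximates_nonneg_functional:
  fixes C :: "(nat \<Rightarrow> real) set" and v :: "nat \<Rightarrow> real"
  assumes curve: "\<And>t. (\<lambda>k. t ^ k) \<in> C"
    and convex: "\<And>c t s. c \<in> C \<Longrightarrow> 0 \<le> s \<Longrightarrow> s \<le> 1 \<Longrightarrow> (\<lambda>k. (1 - s) * c k + s * t ^ k) \<in> C"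
    and v0: "v 0 = 1"
    and nonneg: "\<And>q. (\<And>x. 0 \<le> poly q x) \<Longrightarrow> 0 \<le> hankel_functional v q"
    and N: "even N" and \<delta>: "0 < \<delta>"
  shows "\<exists>c\<in>C. (\<Sum>k\<le>N. (v k - c k)\<^sup>2) < \<delta>"
proof (rule ccontr)
  assume none: "\<not> ?thesis"
  define D where "D c = (\<Sum>k\<le>N. (v k - c k)\<^sup>2)" for c
  define d where "d = Inf (D ` C)"
  have far: "\<delta> \<le> D c" if "c \<in> C" for c
    using none that by (auto simp: D_def not_less)
  have "C \<noteq> {}" using curve by auto
  then have "\<delta> \<le> d" unfolding d_def by (intro cINF_greatest far) auto
  with \<delta> have "0 < d" by simp
  have "bdd_below (D ` C)" by (rule bdd_belowI2[OF far])
  then have d_le: "d \<le> D c" if "c \<in> C" for c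
    unfolding d_def using that by (intro cINF_lower)
  \<comment> \<open>\<open>B\<close> bounds the squared length of every near-minimiser \<open>c\<close>. The constants \<open>B\<close> and \<open>K\<close> must not
    depend on \<open>\<epsilon>\<close>, as \<open>\<epsilon>\<close> tends to zero at the end.\<close>
  define B where "B = 2 * (\<Sum>k\<le>N. (v k)\<^sup>2) + 2 * (d + 1)"
  define K where "K = (1 + 2 * (real N + 1) + 2 * B) / 2"
  have "0 \<le> B" using \<open>0 < d\<close> by (simp add: B_def sum_nonneg)
  then have "0 < K" by (simp add: K_def)
  have bound: "d \<le> \<epsilon> * (K * (1 + \<bar>v N\<bar>))" if \<epsilon>: "0 < \<epsilon>" "\<epsilon> \<le> 1" for \<epsilon>
  proof -
    have "\<exists>c\<in>C. D c < d + \<epsilon>\<^sup>2"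
    proof (rule ccontr)
      assume "\<not> ?thesis"
      then have "d + \<epsilon>\<^sup>2 \<le> d"
        unfolding d_def using \<open>C \<noteq> {}\<close> by (intro cINF_greatest) (auto simp: not_less d_def)
      with \<epsilon> show False by simp
    qed
    then obtain c where c: "c \<in> C" "D c < d + \<epsilon>\<^sup>2" by blast
    have "\<epsilon>\<^sup>2 \<le> 1" using \<epsilon> by (simp add: power_le_one)
    have "(\<Sum>k\<le>N. (c k)\<^sup>2) \<le> (\<Sum>k\<le>N. 2 * (v k)\<^sup>2 + 2 * (v k - c k)\<^sup>2)"
    proof (rule sum_mono)
      fix k
      have "0 \<le> (2 * v k - c k)\<^sup>2" by simp
      then show "(c k)\<^sup>2 \<le> 2 * (v k)\<^sup>2 + 2 * (v k - c k)\<^sup>2"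
        by (simp add: power2_eq_square algebra_simps)
    qed
    also have "\<dots> = 2 * (\<Sum>k\<le>N. (v k)\<^sup>2) + 2 * D c"
      by (simp add: sum.distrib sum_distrib_left D_def)
    also have "\<dots> \<le> B" unfolding B_def using c(2) \<open>\<epsilon>\<^sup>2 \<le> 1\<close> by simp
    finally have c_bound: "(\<Sum>k\<le>N. (c k)\<^sup>2) \<le> B" .
    define w where "w k = c k - v k" for k
    define Q where "Q = (\<Sum>k\<le>N. monom (w k) k)
      + (monom (\<epsilon> * K - (\<Sum>k\<le>N. w k * c k)) 0 + monom (\<epsilon> * K) N)"
    have "0 \<le> poly Q t" for t
    proof -
      \<comment> \<open>The point of the curve at \<open>t\<close> has length at most of order \<open>g\<close>, so a step of size \<open>s\<close>
        towards it moves \<open>c\<close> by a distance at most of order \<open>\<epsilon>\<close>, uniformly in \<open>t\<close>.\<close>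
      define g where "g = 1 + t ^ N"
      define s where "s = \<epsilon> / g"
      define E where "E = (\<Sum>k\<le>N. w k * (t ^ k - c k))"
      define F where "F = (\<Sum>k\<le>N. (t ^ k - c k)\<^sup>2)"
      have g: "1 \<le> g" using N by (simp add: g_def zero_le_even_power)
      then have s: "0 < s" "s \<le> 1" using \<epsilon> by (auto simp: s_def divide_le_eq)
      have "1 \<le> g\<^sup>2" using g by simp
      have "F \<le> (\<Sum>k\<le>N. 2 * g\<^sup>2 + 2 * (c k)\<^sup>2)"
        unfolding F_def
      proof (rule sum_mono)
        fix k assume "k \<in> {..N}"
        then have "\<bar>t ^ k\<bar> \<le> g"
          using power_le_one_plus_even_power[of k N t] N by (simp add: g_def)
        then have "(t ^ k)\<^sup>2 \<le> g\<^sup>2" by (rule power2_le_iff_abs_le[THEN iffD2, rotated]) (use g in simp)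
        moreover have "0 \<le> (t ^ k + c k)\<^sup>2" by simp
        ultimately show "(t ^ k - c k)\<^sup>2 \<le> 2 * g\<^sup>2 + 2 * (c k)\<^sup>2"
          by (simp add: power2_sum power2_diff)
      qed
      also have "\<dots> \<le> 2 * (real N + 1) * g\<^sup>2 + 2 * B"
        using c_bound by (simp add: sum.distrib flip: sum_distrib_left) (simp add: algebra_simps)
      also have "\<dots> \<le> (2 * (real N + 1) + 2 * B) * g\<^sup>2"
        using mult_left_mono[OF \<open>1 \<le> g\<^sup>2\<close>, of "2 * B"] \<open>0 \<le> B\<close> by (simp add: algebra_simps)
      finally have F: "F \<le> (2 * (real N + 1) + 2 * B) * g\<^sup>2" .
      have "d \<le> D (\<lambda>k. (1 - s) * c k + s * t ^ k)"
        using s c by (intro d_le convex) auto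
      also have "\<dots> = (\<Sum>k\<le>N. (v k - c k)\<^sup>2 + 2 * s * (w k * (t ^ k - c k)) + s\<^sup>2 * (t ^ k - c k)\<^sup>2)"
        unfolding D_def by (rule sum.cong) (simp_all add: w_def power2_eq_square algebra_simps)
      also have "\<dots> = D c + 2 * s * E + s\<^sup>2 * F"
        by (simp add: sum.distrib sum_distrib_left D_def E_def F_def)
      finally have "0 \<le> \<epsilon>\<^sup>2 + 2 * s * E + s\<^sup>2 * F" using c(2) by simp
      also have "s\<^sup>2 * F \<le> s\<^sup>2 * ((2 * (real N + 1) + 2 * B) * g\<^sup>2)"
        using F by (intro mult_left_mono) auto
      also have "\<dots> = (2 * (real N + 1) + 2 * B) * \<epsilon>\<^sup>2"
        using g by (simp add: s_def field_simps)
      finally have "0 \<le> 2 * (\<epsilon>\<^sup>2 * K) + 2 * s * E" by (simp add: K_def field_simps)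
      also have "\<dots> = 2 * s * (\<epsilon> * K * g + E)"
        using g by (simp add: s_def field_simps power2_eq_square)
      finally have "0 \<le> \<epsilon> * K * g + E" using s by (simp add: zero_le_mult_iff)
      also have "\<dots> = poly Q t"
        by (simp add: Q_def E_def g_def poly_sum poly_monom algebra_simps sum_subtractf)
      finally show ?thesis .
    qed
    then have "0 \<le> hankel_functional v Q" by (rule nonneg)
    also have "\<dots> = (\<Sum>k\<le>N. w k * v k) - (\<Sum>k\<le>N. w k * c k) + \<epsilon> * K * (1 + v N)"
      by (simp add: Q_def hankel_functional_add hankel_functional_sum hankel_functional_monom v0 algebra_simps)
    also have "(\<Sum>k\<le>N. w k * v k) - (\<Sum>k\<le>N. w k * c k) = - D c"
      unfolding D_def sum_subtractf[symmetric] sum_negf[symmetric]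
      by (rule sum.cong) (simp_all add: w_def power2_eq_square algebra_simps)
    finally have "D c \<le> \<epsilon> * K * (1 + v N)" by simp
    also have "\<dots> \<le> \<epsilon> * K * (1 + \<bar>v N\<bar>)"
      using \<epsilon> \<open>0 < K\<close> by (intro mult_left_mono) auto
    finally show ?thesis using d_le[OF c(1)] by (simp add: algebra_simps)
  qed
  define A where "A = K * (1 + \<bar>v N\<bar>)"
  have "0 < A" using \<open>0 < K\<close> by (simp add: A_def add_pos_nonneg)
  then have "d \<le> d / (A + d) * A"
    using bound[of "d / (A + d)"] \<open>0 < d\<close> unfolding A_def by simp
  then have "d * d \<le> 0" using \<open>0 < A\<close> \<open>0 < d\<close> by (simp add: field_simps)
  with \<open>0 < d\<close> show False by (simp add: mult_le_0_iff)
qed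

text \<open>The moment sequences of finitely supported probability measures contain the moment curve (point
  masses) and admit mixing with a point mass. Approximating the first \<open>2 n\<close> moments with
  an error of at most \<open>1 / (n + 1)\<close> gives convergence of every single moment.\<close>
lemma pmf_approximation_of_nonneg_functional:
  fixes v :: "nat \<Rightarrow> real"
  assumes v0: "v 0 = 1"
    and nonneg: "\<And>q. (\<And>x. 0 \<le> poly q x) \<Longrightarrow> 0 \<le> hankel_functional v q"
  obtains p :: "nat \<Rightarrow> real pmf" where "\<And>n. finite (set_pmf (p n))"
    "\<And>k. (\<lambda>n. measure_pmf.expectation (p n) (\<lambda>x. x ^ k)) \<longlonglongrightarrow> v k"
proof -
  define m where "m p k = measure_pmf.expectation p (\<lambda>x::real. x ^ k)" for p k
  define C where "C = m ` {p. finite (set_pmf p)}"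
  have "\<exists>p. finite (set_pmf p) \<and> (\<Sum>k\<le>2 * n. (v k - m p k)\<^sup>2) < (1 / real (Suc n))\<^sup>2" for n
  proof -
    have "\<exists>c\<in>C. (\<Sum>k\<le>2 * n. (v k - c k)\<^sup>2) < (1 / real (Suc n))\<^sup>2"
    proof (rule convex_set_approximates_nonneg_functional[of C v])
      show "(\<lambda>k. t ^ k) \<in> C" for t
        unfolding C_def by (rule image_eqI[of _ _ "return_pmf t"]) (auto simp: m_def fun_eq_iff)
    next
      fix c :: "nat \<Rightarrow> real" and t s :: real
      assume c: "c \<in> C" and s: "0 \<le> s" "s \<le> 1"
      from c obtain p where p: "finite (set_pmf p)" "c = m p" by (auto simp: C_def)
      define p' where "p' = bernoulli_pmf s \<bind> (\<lambda>b. if b then return_pmf t else p)"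
      have "m p' k = (1 - s) * c k + s * t ^ k" for k
        unfolding m_def p'_def using p s
        by (subst pmf_expectation_bind[of UNIV]) (auto simp: UNIV_bool m_def)
      moreover have "finite (set_pmf p')" using p by (auto simp: p'_def)
      ultimately show "(\<lambda>k. (1 - s) * c k + s * t ^ k) \<in> C"
        unfolding C_def by (intro image_eqI[of _ _ p']) auto
    qed (use v0 nonneg in auto)
    then show ?thesis by (auto simp: C_def)
  qed
  then obtain p where p: "\<And>n. finite (set_pmf (p n))"
    and close: "\<And>n. (\<Sum>k\<le>2 * n. (v k - m (p n) k)\<^sup>2) < (1 / real (Suc n))\<^sup>2"
    by metis
  have "(\<lambda>n. m (p n) k) \<longlonglongrightarrow> v k" for k
  proof (rule Lim_null[THEN iffD2], rule Lim_null_comparison)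
    show "eventually (\<lambda>n. norm (m (p n) k - v k) \<le> 1 / real (Suc n)) sequentially"
      using eventually_ge_at_top[of k]
    proof eventually_elim
      case (elim n)
      have "(v k - m (p n) k)\<^sup>2 \<le> (\<Sum>k\<le>2 * n. (v k - m (p n) k)\<^sup>2)"
        using elim by (intro member_le_sum) auto
      also note close[of n]
      finally have "\<bar>v k - m (p n) k\<bar> < \<bar>1 / real (Suc n)\<bar>"
        by (metis abs_le_square_iff not_le)
      then show ?case by simp
    qed
    show "(\<lambda>n. 1 / real (Suc n)) \<longlonglongrightarrow> 0" by (rule LIMSEQ_Suc[OF lim_1_over_n])
  qed
  then show ?thesis using p by (intro that) (auto simp: m_def)
qed


section \<open>Weak limits preserve convergent moments\<close>

text \<open>Weak convergence controls only integrals of bounded continuous functions, so powers are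
  truncated at height \<open>R\<close>.\<close>
definition clip :: "real \<Rightarrow> real \<Rightarrow> real" where
  "clip R x = max (- R) (min R x)"

text \<open>The quadratic bound is what lets moments of order \<open>2 * k\<close> control the truncation of \<open>x ^ k\<close>.\<close>
lemma clip_error: "\<bar>x - clip R x\<bar> \<le> x\<^sup>2 / R" if "0 < R"
proof (cases "\<bar>x\<bar> \<le> R")
  case False
  then have "\<bar>x - clip R x\<bar> \<le> \<bar>x\<bar>" using that by (auto simp: clip_def)
  also have "\<bar>x\<bar> * R \<le> \<bar>x\<bar> * \<bar>x\<bar>" using False by (intro mult_left_mono) auto
  then have "\<bar>x\<bar> \<le> x\<^sup>2 / R" using that by (simp add: field_simps power2_eq_square)
  finally show ?thesis .
qed (use that in \<open>auto simp: clip_def\<close>)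

lemma abs_clip_le: "0 \<le> R \<Longrightarrow> \<bar>clip R x\<bar> \<le> R"
  by (auto simp: clip_def)

lemma clip_le: "0 \<le> x \<Longrightarrow> 0 \<le> R \<Longrightarrow> clip R x \<le> x"
  by (auto simp: clip_def)

lemma clip_measurable [measurable]: "clip R \<in> borel_measurable borel"
  unfolding clip_def by measurable

lemma isCont_clip_power: "isCont (\<lambda>x. clip R (x ^ k)) x"
  unfolding clip_def by (intro continuous_intros)

lemma (in real_distribution) integrable_clip_power:
  "0 \<le> R \<Longrightarrow> integrable M (\<lambda>x. clip R (x ^ k))"
  by (rule integrable_const_bound[of _ R]) (auto simp: abs_clip_le)

lemma (in real_distribution) clipped_moment_error:
  assumes "integrable M (\<lambda>x. x ^ k)" "integrable M (\<lambda>x. x ^ (2 * k))" "0 < R"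
  shows "\<bar>(\<integral>x. x ^ k \<partial>M) - (\<integral>x. clip R (x ^ k) \<partial>M)\<bar> \<le> (\<integral>x. x ^ (2 * k) \<partial>M) / R"
proof -
  note clip = integrable_clip_power[of R k]
  have "\<bar>(\<integral>x. x ^ k \<partial>M) - (\<integral>x. clip R (x ^ k) \<partial>M)\<bar> = \<bar>\<integral>x. x ^ k - clip R (x ^ k) \<partial>M\<bar>"
    using assms clip by (subst Bochner_Integration.integral_diff) auto
  also have "\<dots> \<le> (\<integral>x. \<bar>x ^ k - clip R (x ^ k)\<bar> \<partial>M)" by (rule integral_abs_bound)
  also have "\<dots> \<le> (\<integral>x. x ^ (2 * k) / R \<partial>M)"
  proof (rule integral_mono)
    show "\<bar>x ^ k - clip R (x ^ k)\<bar> \<le> x ^ (2 * k) / R" for x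
      using clip_error[OF \<open>0 < R\<close>, of "x ^ k"] by (simp add: power_even_eq)
  qed (use assms clip in auto)
  finally show ?thesis by simp
qed

text \<open>By Markov's inequality, the mass outside \<open>{- R<..R}\<close> is at most \<open>B / R\<^sup>2\<close>.\<close>
lemma tight_if_second_moments_bounded:
  assumes dist: "\<And>n. real_distribution (\<mu> n)"
    and int: "\<And>n. integrable (\<mu> n) (\<lambda>x. x\<^sup>2)"
    and bound: "\<And>n. (\<integral>x. x\<^sup>2 \<partial>\<mu> n) \<le> B"
  shows "tight \<mu>"
  unfolding tight_def
proof (intro conjI allI impI dist)
  fix \<epsilon> :: real assume \<epsilon>: "0 < \<epsilon>"
  define R where "R = sqrt ((\<bar>B\<bar> + 1) / \<epsilon>)"
  have "0 < R" and R2: "R\<^sup>2 = (\<bar>B\<bar> + 1) / \<epsilon>"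
    using \<epsilon> by (simp_all add: R_def add_nonneg_pos)
  have "1 - \<epsilon> < measure (\<mu> n) {- R<..R}" for n
  proof -
    interpret real_distribution "\<mu> n" by (rule dist)
    have "measure (\<mu> n) {x \<in> space (\<mu> n). R\<^sup>2 \<le> x\<^sup>2} \<le> (\<integral>x. x\<^sup>2 \<partial>\<mu> n) / R\<^sup>2"
      using \<open>0 < R\<close> by (intro integral_Markov_inequality_measure[where A = "{}"] int) auto
    also have "\<dots> \<le> B / R\<^sup>2" using bound[of n] by (intro divide_right_mono) auto
    also have "B / R\<^sup>2 < \<epsilon>"
    proof -
      have "B * \<epsilon> \<le> \<bar>B\<bar> * \<epsilon>" using \<epsilon> by (intro mult_right_mono) auto
      also have "\<dots> < (\<bar>B\<bar> + 1) * \<epsilon>" using \<epsilon> by simp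
      finally show ?thesis using \<epsilon> by (simp add: R2 divide_less_eq mult.commute)
    qed
    finally have "prob {x. R\<^sup>2 \<le> x\<^sup>2} < \<epsilon>" by simp
    moreover have "prob (- {- R<..R}) \<le> prob {x. R\<^sup>2 \<le> x\<^sup>2}"
      using \<open>0 < R\<close> by (intro finite_measure_mono) (auto simp flip: abs_le_square_iff)
    moreover have "prob (- {- R<..R}) = 1 - prob {- R<..R}"
      using prob_compl[of "{- R<..R}"] by (simp add: Compl_eq_Diff_UNIV)
    ultimately show ?thesis by simp
  qed
  moreover have "- R < R" using \<open>0 < R\<close> by simp
  ultimately show "\<exists>a b. a < b \<and> (\<forall>n. 1 - \<epsilon> < measure (\<mu> n) {a<..b})" by blast
qed

text \<open>Even powers are nonnegative and the increasing limit of their truncations, so this is monotone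
  convergence.\<close>
lemma (in real_distribution) even_moment_from_clipped_bound:
  assumes bound: "\<And>R. 0 < R \<Longrightarrow> (\<integral>x. clip R (x ^ (2 * k)) \<partial>M) \<le> B"
  shows "integrable M (\<lambda>x. x ^ (2 * k))" "(\<integral>x. x ^ (2 * k) \<partial>M) \<le> B"
proof -
  define f where "f i x = clip (real (Suc i)) (x ^ (2 * k))" for i and x :: real
  have f: "integrable M (f i)" "integral\<^sup>L M (f i) \<le> B" for i
    using integrable_clip_power[of "real (Suc i)" "2 * k"] bound[of "real (Suc i)"]
    by (simp_all add: f_def[abs_def])
  have nonneg: "0 \<le> x ^ (2 * k)" for x :: real by (simp add: zero_le_even_power)
  have f_eq: "f i x = min (real (Suc i)) (x ^ (2 * k))" for i x
    unfolding f_def clip_def by (rule max_absorb2) (use nonneg[of x] in linarith)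
  have mono: "mono (\<lambda>i. f i x)" for x
    by (auto simp: mono_def f_eq)
  have "incseq (\<lambda>i. integral\<^sup>L M (f i))"
    using mono by (auto intro!: incseq_SucI integral_mono f simp: mono_def)
  then obtain L where L: "(\<lambda>i. integral\<^sup>L M (f i)) \<longlonglongrightarrow> L"
    using incseq_convergent[of "\<lambda>i. integral\<^sup>L M (f i)" B] f(2) by blast
  have "(\<lambda>i. f i x) \<longlonglongrightarrow> x ^ (2 * k)" for x
  proof (rule tendsto_eventually)
    obtain n where n: "x ^ (2 * k) \<le> real n" using real_arch_simple by blast
    show "eventually (\<lambda>i. f i x = x ^ (2 * k)) sequentially"
      using eventually_ge_at_top[of n]
      by eventually_elim (use n nonneg[of x] in \<open>auto simp: f_eq\<close>)
  qed
  then have "integrable M (\<lambda>x. x ^ (2 * k))" "(\<integral>x. x ^ (2 * k) \<partial>M) = L"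
    using integral_monotone_convergence_nonneg[of M f "\<lambda>x. x ^ (2 * k)" L] f L mono nonneg
    by (auto simp: f_eq)
  then show "integrable M (\<lambda>x. x ^ (2 * k))" "(\<integral>x. x ^ (2 * k) \<partial>M) \<le> B"
    using LIMSEQ_le_const2[OF L] f(2) by auto
qed

lemma (in real_distribution) integrable_power_from_even:
  assumes "integrable M (\<lambda>x. x ^ (2 * k))"
  shows "integrable M (\<lambda>x. x ^ k)"
proof (rule Bochner_Integration.integrable_bound)
  show "integrable M (\<lambda>x. 1 + x ^ (2 * k))" using assms by auto
  show "AE x in M. norm (x ^ k) \<le> norm (1 + x ^ (2 * k))"
    using power_le_one_plus_even_power[of k "2 * k"]
    by (auto intro!: AE_I2)
qed simp

text \<open>Along a weakly convergent subsequence, truncated moments converge to those of the limit \<open>M\<close>.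
  The truncation changes the moment of order \<open>k\<close> by at most \<open>B (2 * k) / R\<close>, both for the sequence
  and for \<open>M\<close>; letting \<open>R\<close> tend to infinity removes it.\<close>
lemma moment_limit:
  fixes \<mu> :: "nat \<Rightarrow> real measure"
  assumes dist: "\<And>n. real_distribution (\<mu> n)"
    and int: "\<And>n k. integrable (\<mu> n) (\<lambda>x. x ^ k)"
    and lim: "\<And>k. (\<lambda>n. \<integral>x. x ^ k \<partial>\<mu> n) \<longlonglongrightarrow> v k"
  obtains M where "real_distribution M" "\<And>k. integrable M (\<lambda>x. x ^ k)"
    "\<And>k. (\<integral>x. x ^ k \<partial>M) = v k"
proof -
  have "\<exists>B. \<forall>n. (\<integral>x. x ^ k \<partial>\<mu> n) \<le> B" for k
  proof -
    have "Bseq (\<lambda>n. \<integral>x. x ^ k \<partial>\<mu> n)"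
      using lim by (intro convergent_imp_Bseq convergentI)
    then obtain B where "\<forall>n. norm (\<integral>x. x ^ k \<partial>\<mu> n) \<le> B" by (rule BseqE)
    then show ?thesis by (intro exI[of _ B]) (auto simp: abs_le_iff)
  qed
  then obtain B where B: "\<And>k n. (\<integral>x. x ^ k \<partial>\<mu> n) \<le> B k" by metis
  have "tight \<mu>" by (rule tight_if_second_moments_bounded[OF dist int B])
  from tight_imp_convergent_subsubsequence[OF this strict_mono_id]
  obtain r M where r: "strict_mono r" and M: "real_distribution M"
    and weak: "weak_conv_m (\<lambda>n. \<mu> (r n)) M"
    by (auto simp: o_def)
  interpret M: real_distribution M by (rule M)
  have clip_lim: "(\<lambda>n. \<integral>x. clip R (x ^ k) \<partial>\<mu> (r n)) \<longlonglongrightarrow> (\<integral>x. clip R (x ^ k) \<partial>M)" if "0 < R" for R k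
    by (rule weak_conv_imp_integral_bdd_continuous_conv[OF dist M weak isCont_clip_power, of _ _ R])
      (use that in \<open>simp add: abs_clip_le\<close>)
  have even: "integrable M (\<lambda>x. x ^ (2 * k))" "(\<integral>x. x ^ (2 * k) \<partial>M) \<le> B (2 * k)" for k
  proof -
    have "(\<integral>x. clip R (x ^ (2 * k)) \<partial>M) \<le> B (2 * k)" if "0 < R" for R
    proof (rule LIMSEQ_le_const2[OF clip_lim[OF that]], intro exI allI impI)
      fix n
      interpret \<mu>: real_distribution "\<mu> (r n)" by (rule dist)
      have "(\<integral>x. clip R (x ^ (2 * k)) \<partial>\<mu> (r n)) \<le> (\<integral>x. x ^ (2 * k) \<partial>\<mu> (r n))"
        using that by (intro integral_mono int \<mu>.integrable_clip_power clip_le)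
          (auto simp: zero_le_even_power)
      also note B
      finally show "(\<integral>x. clip R (x ^ (2 * k)) \<partial>\<mu> (r n)) \<le> B (2 * k)" .
    qed
    then show "integrable M (\<lambda>x. x ^ (2 * k))" "(\<integral>x. x ^ (2 * k) \<partial>M) \<le> B (2 * k)"
      by (rule M.even_moment_from_clipped_bound, blast)+
  qed
  have int_M: "integrable M (\<lambda>x. x ^ k)" for k
    by (rule M.integrable_power_from_even[OF even(1)])
  have "(\<integral>x. x ^ k \<partial>M) = v k" for k
  proof -
    have close: "\<bar>(\<integral>x. x ^ k \<partial>M) - v k\<bar> \<le> 2 * B (2 * k) / R" if R: "0 < R" for R
    proof -
      have "\<bar>(\<integral>x. x ^ k \<partial>M) - (\<integral>x. clip R (x ^ k) \<partial>M)\<bar> \<le> (\<integral>x. x ^ (2 * k) \<partial>M) / R"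
        by (rule M.clipped_moment_error[OF int_M int_M R])
      also have "\<dots> \<le> B (2 * k) / R" using even(2) R by (intro divide_right_mono) auto
      finally have 1: "\<bar>(\<integral>x. x ^ k \<partial>M) - (\<integral>x. clip R (x ^ k) \<partial>M)\<bar> \<le> B (2 * k) / R" .
      have "(\<lambda>n. \<bar>(\<integral>x. x ^ k \<partial>\<mu> (r n)) - (\<integral>x. clip R (x ^ k) \<partial>\<mu> (r n))\<bar>)
          \<longlonglongrightarrow> \<bar>v k - (\<integral>x. clip R (x ^ k) \<partial>M)\<bar>"
        using LIMSEQ_subseq_LIMSEQ[OF lim r] clip_lim[OF R]
        by (intro tendsto_intros) (simp_all add: o_def)
      then have 2: "\<bar>v k - (\<integral>x. clip R (x ^ k) \<partial>M)\<bar> \<le> B (2 * k) / R"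
      proof (rule LIMSEQ_le_const2, intro exI allI impI)
        fix n
        interpret \<mu>: real_distribution "\<mu> (r n)" by (rule dist)
        have "\<bar>(\<integral>x. x ^ k \<partial>\<mu> (r n)) - (\<integral>x. clip R (x ^ k) \<partial>\<mu> (r n))\<bar>
            \<le> (\<integral>x. x ^ (2 * k) \<partial>\<mu> (r n)) / R"
          by (rule \<mu>.clipped_moment_error[OF int int R])
        also have "\<dots> \<le> B (2 * k) / R" using B R by (intro divide_right_mono) auto
        finally show "\<bar>(\<integral>x. x ^ k \<partial>\<mu> (r n)) - (\<integral>x. clip R (x ^ k) \<partial>\<mu> (r n))\<bar> \<le> B (2 * k) / R" .
      qed
      from 1 2 show ?thesis by (simp add: field_simps)
    qed
    have "(\<lambda>n. 2 * B (2 * k) / real (Suc n)) \<longlonglongrightarrow> 0"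
      by (rule LIMSEQ_Suc[OF lim_const_over_n])
    then have "\<bar>(\<integral>x. x ^ k \<partial>M) - v k\<bar> \<le> 0"
      by (rule LIMSEQ_le_const) (use close in auto)
    then show ?thesis by simp
  qed
  with M int_M show ?thesis by (rule that)
qed

section \<open>Hamburger's theorem\<close>

text \<open>If \<open>v 0 > 0\<close>, the sequence is divided by \<open>v 0\<close> to make it the moment sequence of a probability
  measure. If \<open>v 0 = 0\<close>, the Cauchy-Schwarz inequality for the functional forces \<open>v\<close> to vanish, and the
  null measure represents it.\<close>
theorem hamburger:
  fixes v :: "nat \<Rightarrow> real"
  assumes psd: "\<And>p x. 0 \<le> (\<Sum>i<p. \<Sum>j<p. x i * x j * v (i + j))"
  obtains M :: "real measure" where "sets M = sets borel" "\<And>k. integrable M (\<lambda>x. x ^ k)"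
    "\<And>k. (\<integral>x. x ^ k \<partial>M) = v k"
proof -
  have square: "0 \<le> hankel_functional v (p * p)" for p
    unfolding hankel_functional_square using psd[where p = "Suc (degree p)" and x = "coeff p"]
    by (simp only: lessThan_Suc_atMost)
  have nonneg: "0 \<le> hankel_functional v q" if "\<And>x. 0 \<le> poly q x" for q
    by (rule nonneg_on_squares_imp_nonneg_on_nonneg_polys
        [OF hankel_functional_add hankel_functional_smult square that])
  have even_nonneg: "0 \<le> v (2 * k)" for k
    using nonneg[of "monom 1 (2 * k)"] by (simp add: hankel_functional_monom poly_monom zero_le_even_power)
  show ?thesis
  proof (cases "v 0 = 0")
    case True
    have "v k = 0" for k
    proof -
      \<comment> \<open>The value at \<open>(a + x ^ k)\<^sup>2\<close> is affine in \<open>a\<close> because \<open>v 0 = 0\<close>, so its slope must vanish.\<close>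
      have quad: "0 \<le> 2 * v k * a + v (2 * k)" for a
      proof -
        have "0 \<le> hankel_functional v ((monom a 0 + monom 1 k) * (monom a 0 + monom 1 k))"
          by (rule square)
        also have "\<dots> = 2 * v k * a + v (2 * k)"
          by (simp only: distrib_left distrib_right mult_monom hankel_functional_add
              hankel_functional_monom) (simp add: True flip: mult_2)
        finally show ?thesis .
      qed
      show ?thesis
      proof (rule ccontr)
        assume "v k \<noteq> 0"
        with quad[of "- (v (2 * k) + 1) / (2 * v k)"] show False by (simp add: field_simps)
      qed
    qed
    then show ?thesis by (intro that[of "null_measure borel"]) auto
  next
    case False
    with even_nonneg[of 0] have v0: "0 < v 0" by simp
    define u where "u k = v k / v 0" for k
    have "0 \<le> hankel_functional u q" if "\<And>x. 0 \<le> poly q x" for q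
    proof -
      have "hankel_functional u q = hankel_functional v q / v 0"
        by (simp add: hankel_functional_def u_def sum_divide_distrib)
      then show ?thesis using nonneg[OF that] v0 by simp
    qed
    then obtain p where p: "\<And>n. finite (set_pmf (p n))"
      and lim: "\<And>k. (\<lambda>n. measure_pmf.expectation (p n) (\<lambda>x. x ^ k)) \<longlonglongrightarrow> u k"
      using pmf_approximation_of_nonneg_functional[of u] v0 by (auto simp: u_def)
    define \<mu> where "\<mu> n = distr (measure_pmf (p n)) borel (\<lambda>x. x)" for n
    obtain P where P: "real_distribution P" "\<And>k. integrable P (\<lambda>x. x ^ k)"
      "\<And>k. (\<integral>x. x ^ k \<partial>P) = u k"
    proof (rule moment_limit[of \<mu> u])
      show "real_distribution (\<mu> n)" for n
        unfolding \<mu>_def by (rule prob_space.real_distribution_distr[OF prob_space_measure_pmf]) simp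
      show "integrable (\<mu> n) (\<lambda>x. x ^ k)" for n k
        unfolding \<mu>_def using p by (subst integrable_distr_eq) (auto intro: integrable_measure_pmf_finite)
      show "(\<lambda>n. \<integral>x. x ^ k \<partial>\<mu> n) \<longlonglongrightarrow> u k" for k
        unfolding \<mu>_def using lim by (subst integral_distr) auto
    qed blast
    interpret real_distribution P by (rule P)
    show ?thesis
    proof (rule that[of "density P (\<lambda>_. ennreal (v 0))"])
      show "integrable (density P (\<lambda>_. ennreal (v 0))) (\<lambda>x. x ^ k)" for k
        using P(2) v0 by (subst integrable_density) auto
      show "(\<integral>x. x ^ k \<partial>density P (\<lambda>_. ennreal (v 0))) = v k" for k
        using P(3)[of k] v0 by (subst integral_density) (auto simp: u_def)
    qed simp
  qed
qed

section \<open>The moment curve\<close>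

text \<open>Here the weight is a sum over the coordinates themselves: coordinate \<open>i\<close> has as coefficient its
  position in the enumeration \<open>e\<close>, which is also its exponent on the moment curve.\<close>
lemma multi_index_weight_eq_sum:
  fixes e :: "nat \<Rightarrow> 'm::finite"
  assumes "bij_betw e {1..n - 1} UNIV"
  shows "multi_index_weight n e j = (\<Sum>i\<in>UNIV. the_inv_into {1..n - 1} e i * j i)"
  unfolding multi_index_weight_def
  by (subst sum.reindex_bij_betw[OF assms, symmetric])
    (use assms in \<open>simp add: bij_betw_def the_inv_into_f_f\<close>)

lemma integrable_and_integral_monomial_power_curve:
  fixes M :: "real measure" and d :: "'m::finite \<Rightarrow> nat"
  assumes "sets M = sets borel" "integrable M (\<lambda>x. x ^ (\<Sum>i\<in>UNIV. d i * j i))"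
  defines "\<nu> \<equiv> distr M borel (\<lambda>x. (\<chi> i. x ^ d i) :: real ^ 'm)"
  shows "integrable \<nu> (\<lambda>t. \<Prod>i\<in>UNIV. (t $ i) ^ j i)"
    and "(\<integral>t. (\<Prod>i\<in>UNIV. (t $ i) ^ j i) \<partial>\<nu>) = (\<integral>x. x ^ (\<Sum>i\<in>UNIV. d i * j i) \<partial>M)"
proof -
  have "(\<lambda>x. (\<chi> i. x ^ d i) :: real ^ 'm) \<in> borel_measurable borel"
    by (intro borel_measurable_continuous_onI continuous_intros)
  then have curve: "(\<lambda>x. (\<chi> i. x ^ d i) :: real ^ 'm) \<in> borel_measurable M"
    using assms(1) by (simp cong: measurable_cong_sets)
  have monomial: "(\<lambda>t :: real ^ 'm. \<Prod>i\<in>UNIV. (t $ i) ^ j i) \<in> borel_measurable borel"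
    by (intro borel_measurable_continuous_onI continuous_intros)
  have pullback: "(\<Prod>i\<in>UNIV. (((\<chi> i. x ^ d i) :: real ^ 'm) $ i) ^ j i) = x ^ (\<Sum>i\<in>UNIV. d i * j i)"
    for x :: real
    by (simp add: power_sum flip: power_mult)
  show "integrable \<nu> (\<lambda>t. \<Prod>i\<in>UNIV. (t $ i) ^ j i)"
    unfolding \<nu>_def integrable_distr_eq[OF curve monomial] pullback by (rule assms)
  show "(\<integral>t. (\<Prod>i\<in>UNIV. (t $ i) ^ j i) \<partial>\<nu>) = (\<integral>x. x ^ (\<Sum>i\<in>UNIV. d i * j i) \<partial>M)"
    unfolding \<nu>_def integral_distr[OF curve monomial] pullback ..
qed

theorem theorem1:
  fixes n :: nat
    and e :: "nat \<Rightarrow> 'm::finite"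
    and b :: "('m \<Rightarrow> nat) \<Rightarrow> real"
    and v :: "nat \<Rightarrow> real"
  assumes "n \<ge> 2"
    and "bij_betw e {1..n - 1} (UNIV :: 'm set)"
    and "hankel_multidim_sequence n e b"
    and "\<And>j. v (multi_index_weight n e j) = b j"
    and "\<And>p. p \<ge> 1 \<Longrightarrow> positive_semidefinite_mat (hankel_mat v p)"
  shows "multidim_moment_sequence b"
proof -
  have "0 \<le> (\<Sum>i<p. \<Sum>j<p. x i * x j * v (i + j))" for p x
    using assms(5)[of p] positive_semidefinite_hankel_mat_quadratic_form[of v p x]
    by (cases "p = 0") auto
  then obtain M where M: "sets M = sets borel" "\<And>k. integrable M (\<lambda>x. x ^ k)"
    and moments: "\<And>k. (\<integral>x. x ^ k \<partial>M) = v k"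
    by (rule hamburger) blast
  define d where "d = the_inv_into {1..n - 1} e"
  have weight: "multi_index_weight n e j = (\<Sum>i\<in>UNIV. d i * j i)" for j
    unfolding d_def by (rule multi_index_weight_eq_sum[OF assms(2)])
  define \<nu> where "\<nu> = distr M borel (\<lambda>x. (\<chi> i. x ^ d i) :: real ^ 'm)"
  have "integrable \<nu> (\<lambda>t. \<Prod>i\<in>UNIV. (t $ i) ^ j i)"
    "b j = (\<integral>t. (\<Prod>i\<in>UNIV. (t $ i) ^ j i) \<partial>\<nu>)" for j
    using integrable_and_integral_monomial_power_curve[OF M(1) M(2), of d j]
    by (simp_all add: \<nu>_def moments flip: assms(4) weight)
  moreover have "sets \<nu> = sets borel" by (simp add: \<nu>_def)
  ultimately show ?thesis unfolding multidim_moment_sequence_def by blast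
qed

end
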